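(* Let $T$ be a tree of order $n\geq 3$ with $p$ pendent edges. Then $$Sz_{n-1}(T)=n+p-1 \qquad\text{and}\qquad rSz_{n-1}(T)=2p+\frac{9}{4}(n-p-1).$$
   Context: A pendent edge is an edge incident to a vertex of degree $1$. For a connected graph $G$ and $S\subseteq V(G)$, the Steiner distance $d_G(S)$ is the minimum number of edges of a connected subgraph of $G$ whose vertex set contains $S$. For an edge $e=uv$ of $G$ and a positive integer $k$, define $N_u(e;k)=\{S'\subseteq V(G)\setminus\{u,v\} : |S'|=k-1,\ d_G(S'\cup\{u\})<d_G(S'\cup\{v\})\}$, $N_v(e;k)=\{S'\subseteq V(G)\setminus\{u,v\} : |S'|=k-1,\ d_G(S'\cup\{v\})<d_G(S'\cup\{u\})\}$, $N_0(e;k)=\{S'\subseteq V(G)\setminus\{u,v\} : |S'|=k-1,\ d_G(S'\cup\{u\})=d_G(S'\cup\{v\})\}$, with $n_u(e;k),n_v(e;k),n_0(e;k)$ their cardinalities. $Sz_k(G)=\sum_{e=uv\in E(G)}(n_u(e;k)+1)(n_v(e;k)+1)$ and $rSz_k(G)=\sum_{e=uv\in E(G)}(n_u(e;k)+n_0(e;k)/2+1)(n_v(e;k)+n_0(e;k)/2+1)$. *)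

theory Defs
  imports Complex_Main
begin

text \<open>A finite simple graph is given by its vertex set \<open>V\<close> and its set \<open>E\<close> of edges, an edge being
  the two-element set of its endpoints.\<close>

definition simple_graph :: "'a set \<Rightarrow> 'a set set \<Rightarrow> bool" where
  "simple_graph V E \<longleftrightarrow> finite V \<and> (\<forall>e\<in>E. e \<subseteq> V \<and> card e = 2)"

definition subgraph :: "'a set \<Rightarrow> 'a set set \<Rightarrow> 'a set \<Rightarrow> 'a set set \<Rightarrow> bool" where
  "subgraph W F V E \<longleftrightarrow> simple_graph W F \<and> W \<subseteq> V \<and> F \<subseteq> E"

definition connected_graph :: "'a set \<Rightarrow> 'a set set \<Rightarrow> bool" where
  "connected_graph V E \<longleftrightarrow> simple_graph V E \<and> V \<noteq> {} \<and>
     (\<forall>u\<in>V. \<forall>v\<in>V. (u, v) \<in> {(x, y). {x, y} \<in> E}\<^sup>*)"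

definition cycle :: "'a set set \<Rightarrow> 'a list \<Rightarrow> bool" where
  "cycle E c \<longleftrightarrow> 3 \<le> length c \<and> distinct c \<and>
     (\<forall>i<length c. {c ! i, c ! (Suc i mod length c)} \<in> E)"

definition tree :: "'a set \<Rightarrow> 'a set set \<Rightarrow> bool" where
  "tree V E \<longleftrightarrow> connected_graph V E \<and> (\<nexists>c. cycle E c)"

definition degree :: "'a set set \<Rightarrow> 'a \<Rightarrow> nat" where
  "degree E v = card {e \<in> E. v \<in> e}"

definition pendent_edges :: "'a set set \<Rightarrow> 'a set set" where
  "pendent_edges E = {e \<in> E. \<exists>v\<in>e. degree E v = 1}"

text \<open>Meaningful for connected graphs and \<open>S \<subseteq> V\<close>; only then is the minimum taken over a set that
  is guaranteed to be nonempty.\<close>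

definition steiner_dist :: "'a set \<Rightarrow> 'a set set \<Rightarrow> 'a set \<Rightarrow> nat" where
  "steiner_dist V E S =
     (LEAST m. \<exists>W F. subgraph W F V E \<and> connected_graph W F \<and> S \<subseteq> W \<and> card F = m)"

text \<open>For an edge \<open>e = {u, v}\<close>, \<open>closer_sets V E e u k\<close> is \<open>N\<^sub>u(e;k)\<close>, \<open>closer_sets V E e v k\<close> is
  \<open>N\<^sub>v(e;k)\<close> and \<open>equidistant_sets V E e k\<close> is \<open>N\<^sub>0(e;k)\<close>. The set \<open>e - {w}\<close> consists of the endpoint
  of \<open>e\<close> other than \<open>w\<close>, so no orientation of \<open>e\<close> has to be chosen.\<close>

definition closer_sets :: "'a set \<Rightarrow> 'a set set \<Rightarrow> 'a set \<Rightarrow> 'a \<Rightarrow> nat \<Rightarrow> 'a set set" where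
  "closer_sets V E e w k = {S. S \<subseteq> V - e \<and> card S = k - 1 \<and>
     steiner_dist V E (S \<union> {w}) < steiner_dist V E (S \<union> (e - {w}))}"

definition equidistant_sets :: "'a set \<Rightarrow> 'a set set \<Rightarrow> 'a set \<Rightarrow> nat \<Rightarrow> 'a set set" where
  "equidistant_sets V E e k = {S. S \<subseteq> V - e \<and> card S = k - 1 \<and>
     (\<forall>u\<in>e. \<forall>v\<in>e. steiner_dist V E (S \<union> {u}) = steiner_dist V E (S \<union> {v}))}"

text \<open>The products over \<open>w \<in> e\<close> have exactly two factors, one for each endpoint of the edge.\<close>

definition Sz :: "nat \<Rightarrow> 'a set \<Rightarrow> 'a set set \<Rightarrow> nat" where
  "Sz k V E = (\<Sum>e\<in>E. \<Prod>w\<in>e. (card (closer_sets V E e w k) + 1))"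

definition rSz :: "nat \<Rightarrow> 'a set \<Rightarrow> 'a set set \<Rightarrow> real" where
  "rSz k V E = (\<Sum>e\<in>E. \<Prod>w\<in>e.
     (real (card (closer_sets V E e w k)) + real (card (equidistant_sets V E e k)) / 2 + 1))"

lemma closer_sets_edge:
  assumes "u \<noteq> v"
  shows "closer_sets V E {u, v} u k = {S. S \<subseteq> V - {u, v} \<and> card S = k - 1 \<and>
           steiner_dist V E (S \<union> {u}) < steiner_dist V E (S \<union> {v})}"
    and "closer_sets V E {u, v} v k = {S. S \<subseteq> V - {u, v} \<and> card S = k - 1 \<and>
           steiner_dist V E (S \<union> {v}) < steiner_dist V E (S \<union> {u})}"
proof -
  have "{u, v} - {u} = {v}" "{u, v} - {v} = {u}" using assms by auto
  then show "closer_sets V E {u, v} u k = {S. S \<subseteq> V - {u, v} \<and> card S = k - 1 \<and>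
           steiner_dist V E (S \<union> {u}) < steiner_dist V E (S \<union> {v})}"
    and "closer_sets V E {u, v} v k = {S. S \<subseteq> V - {u, v} \<and> card S = k - 1 \<and>
           steiner_dist V E (S \<union> {v}) < steiner_dist V E (S \<union> {u})}"
    unfolding closer_sets_def by simp_all
qed

lemma equidistant_sets_edge:
  "equidistant_sets V E {u, v} k = {S. S \<subseteq> V - {u, v} \<and> card S = k - 1 \<and>
     steiner_dist V E (S \<union> {u}) = steiner_dist V E (S \<union> {v})}"
  unfolding equidistant_sets_def by auto

end

theory Submission
  imports Defs
begin

text \<open>For \<open>k = n - 1\<close> the only admissible set is \<open>S' = V - {u, v}\<close>, so all that matters is the Steiner
  distance of \<open>V - {w}\<close>. It is \<open>n - 2\<close> if \<open>w\<close> is a leaf (delete \<open>w\<close>) and \<open>n - 1\<close> otherwise, since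
  a connected subgraph avoiding \<open>w\<close> would join two neighbours of \<open>w\<close> and close a cycle through \<open>w\<close>.
  As \<open>n \<ge> 3\<close>, a pendent edge has exactly one leaf, so pendent edges contribute \<open>2\<close> to both
  indices and the other ones \<open>1\<close> and \<open>9/4\<close>, respectively.\<close>

section \<open>Walks, paths and cycles\<close>

abbreviation adj :: "'a set set \<Rightarrow> ('a \<times> 'a) set" where
  "adj E \<equiv> {(x, y). {x, y} \<in> E}"

lemma rtrancl_adj_sym: "(x, y) \<in> (adj E)\<^sup>* \<Longrightarrow> (y, x) \<in> (adj E)\<^sup>*"
proof -
  have "sym (adj E)" by (auto simp: sym_def insert_commute)
  then show "(x, y) \<in> (adj E)\<^sup>* \<Longrightarrow> (y, x) \<in> (adj E)\<^sup>*"
    using sym_rtrancl by (auto dest: symD)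
qed

lemma rtrancl_adj_mono: "(x, y) \<in> (adj F)\<^sup>* \<Longrightarrow> F \<subseteq> E \<Longrightarrow> (x, y) \<in> (adj E)\<^sup>*"
  by (erule rtrancl_mono[THEN subsetD, rotated]) auto

text \<open>Induction on the walk: a fresh vertex is appended to the path, and a vertex already
  visited cuts the path back to its occurrence.\<close>

lemma distinct_path:
  assumes "(u, v) \<in> (adj F)\<^sup>*"
  shows "\<exists>c. c \<noteq> [] \<and> hd c = u \<and> last c = v \<and> distinct c \<and>
    (\<forall>i. Suc i < length c \<longrightarrow> {c ! i, c ! Suc i} \<in> F)"
  using assms
proof (induction rule: rtrancl_induct)
  case base
  show ?case by (rule exI[of _ "[u]"]) simp
next
  case (step y z)
  then obtain c where c: "c \<noteq> []" "hd c = u" "last c = y" "distinct c"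
    "\<And>i. Suc i < length c \<Longrightarrow> {c ! i, c ! Suc i} \<in> F" by blast
  show ?case
  proof (cases "z \<in> set c")
    case True
    then obtain j where j: "j < length c" "c ! j = z" by (auto simp: in_set_conv_nth)
    have "last (take (Suc j) c) = z" using j by (simp add: take_Suc_conv_app_nth)
    then show ?thesis
      by (intro exI[of _ "take (Suc j) c"]) (use c in \<open>auto simp: hd_conv_nth\<close>)
  next
    case False
    show ?thesis
    proof (rule exI[of _ "c @ [z]"], intro conjI allI impI)
      fix i assume "Suc i < length (c @ [z])"
      then consider "Suc i < length c" | "Suc i = length c" by fastforce
      then show "{(c @ [z]) ! i, (c @ [z]) ! Suc i} \<in> F"
      proof cases
        case 2
        then have "i = length c - 1" "i < length c" by auto
        then have "c ! i = y" using c by (simp add: last_conv_nth)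
        then show ?thesis using 2 step(2) \<open>i < length c\<close> by (simp add: nth_append)
      qed (use c in \<open>simp add: nth_append\<close>)
    qed (use c False in auto)
  qed
qed

text \<open>The edge \<open>{u, v}\<close> closes a path inside \<open>F\<close>. Both uses of
  acyclicity below go through this lemma.\<close>

lemma cycle_if_path_and_edge:
  assumes "(u, v) \<in> (adj F)\<^sup>*" "F \<subseteq> E" "{u, v} \<in> E" "{u, v} \<notin> F" "u \<noteq> v"
  shows "\<exists>c. cycle E c"
proof -
  from distinct_path[OF assms(1)] obtain c where c: "c \<noteq> []" "hd c = u" "last c = v" "distinct c"
    "\<And>i. Suc i < length c \<Longrightarrow> {c ! i, c ! Suc i} \<in> F" by blast
  then have uv: "c ! 0 = u" "c ! (length c - 1) = v" by (simp_all add: hd_conv_nth last_conv_nth)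
  \<comment> \<open>Length 1 would force \<open>u = v\<close>; length 2 would make
    \<open>{u, v}\<close> the only edge of the path, hence an edge of \<open>F\<close>.\<close>
  have "length c \<noteq> 0" "length c \<noteq> 1" "length c \<noteq> 2"
    using c(1) uv assms(4,5) c(5)[of 0] by (auto simp: numeral_2_eq_2)
  then have "3 \<le> length c" by linarith
  moreover have "{c ! i, c ! (Suc i mod length c)} \<in> E" if "i < length c" for i
  proof (cases "Suc i < length c")
    case True
    then show ?thesis using c(5) assms(2) by auto
  next
    case False
    then have "Suc i = length c" "i = length c - 1" using that by simp_all
    then have "c ! i = v" "Suc i mod length c = 0" using uv by auto
    then show ?thesis using uv assms(3) by (simp add: insert_commute)
  qed
  ultimately show ?thesis using c(4) unfolding cycle_def by blast
qed

section \<open>Spanning trees and the number of edges\<close>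

lemma simple_graph_finite_edges: "simple_graph V E \<Longrightarrow> finite E"
  unfolding simple_graph_def by (meson Pow_iff finite_Pow_iff finite_subset subsetI)

lemma crossing_edge:
  assumes "(a, b) \<in> (adj E)\<^sup>*" "a \<in> W" "b \<notin> W"
  shows "\<exists>x y. x \<in> W \<and> y \<notin> W \<and> {x, y} \<in> E"
  using assms by (induction rule: rtrancl_induct) auto

text \<open>A tree is grown from a single vertex: as long as \<open>W\<close> is not all of
  \<open>V\<close>, some edge leaves \<open>W\<close>, and adding it brings in exactly one new
  vertex.\<close>

lemma connected_subgraph_grow:
  assumes "connected_graph V E" "m < card V"
  shows "\<exists>W F. subgraph W F V E \<and> connected_graph W F \<and> card W = Suc m \<and> card F = m"
  using assms(2)
proof (induction m)
  case 0
  obtain r where "r \<in> V" using assms(1) by (auto simp: connected_graph_def)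
  then show ?case
    by (intro exI[of _ "{r}"] exI[of _ "{}"])
      (auto simp: subgraph_def connected_graph_def simple_graph_def)
next
  case (Suc m)
  then obtain W F where WF: "subgraph W F V E" "connected_graph W F" "card W = Suc m" "card F = m"
    by auto
  have sg: "simple_graph V E" using assms(1) by (simp add: connected_graph_def)
  have sW: "simple_graph W F" "W \<subseteq> V" "F \<subseteq> E" using WF(1) by (auto simp: subgraph_def)
  obtain a where a: "a \<in> W" using WF(2) by (auto simp: connected_graph_def)
  have "W \<noteq> V" using WF(3) Suc.prems by auto
  then obtain b where "b \<in> V" "b \<notin> W" using sW by auto
  moreover have "(a, b) \<in> (adj E)\<^sup>*"
    using assms(1) a sW \<open>b \<in> V\<close> unfolding connected_graph_def by blast
  ultimately obtain x y where xy: "x \<in> W" "y \<notin> W" "{x, y} \<in> E"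
    using crossing_edge a by metis
  have yV: "y \<in> V" using xy(3) sg unfolding simple_graph_def by blast
  have new: "{x, y} \<notin> F" using sW xy unfolding simple_graph_def by blast
  let ?W = "insert y W" and ?F = "insert {x, y} F"
  have "x \<noteq> y" using xy by blast
  then have s: "simple_graph ?W ?F" using sW xy by (auto simp: simple_graph_def)
  \<comment> \<open>It suffices to reach the attachment point \<open>x\<close> from everywhere;
    symmetry then joins any two vertices through \<open>x\<close>.\<close>
  have tox: "(z, x) \<in> (adj ?F)\<^sup>*" if "z \<in> ?W" for z
  proof (cases "z = y")
    case True
    then show ?thesis by (auto intro!: r_into_rtrancl simp: insert_commute)
  next
    case False
    then have "(z, x) \<in> (adj F)\<^sup>*" using that xy WF(2) by (auto simp: connected_graph_def)
    then show ?thesis by (rule rtrancl_adj_mono) auto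
  qed
  have "connected_graph ?W ?F"
    unfolding connected_graph_def
  proof (intro conjI ballI)
    show "(z, z') \<in> (adj ?F)\<^sup>*" if "z \<in> ?W" "z' \<in> ?W" for z z'
      using tox[OF that(1)] rtrancl_adj_sym[OF tox[OF that(2)]] by (rule rtrancl_trans)
  qed (use s in auto)
  moreover have "subgraph ?W ?F V E" using s yV sW xy by (auto simp: subgraph_def)
  moreover have "card ?W = Suc (Suc m)" "card ?F = Suc m"
    using WF xy new sW simple_graph_finite_edges[OF sW(1)]
    by (auto simp: simple_graph_def)
  ultimately show ?case by blast
qed

lemma spanning_connected_subgraph:
  assumes "connected_graph V E"
  shows "\<exists>F\<subseteq>E. connected_graph V F \<and> Suc (card F) = card V"
proof -
  have fin: "finite V" "V \<noteq> {}" using assms by (auto simp: connected_graph_def simple_graph_def)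
  then have "card V > 0" by auto
  with connected_subgraph_grow[OF assms, of "card V - 1"] obtain W F where
    "subgraph W F V E" "connected_graph W F" "card W = card V" "Suc (card F) = card V" by auto
  moreover from this(1,3) have "W = V" using card_subset_eq[OF fin(1)] by (simp add: subgraph_def)
  ultimately show ?thesis by (auto simp: subgraph_def)
qed

text \<open>A spanning tree already has \<open>card V - 1\<close> edges. This is the lower bound for
  the subgraphs competing in a Steiner distance.\<close>

lemma connected_graph_card_le:
  assumes "connected_graph V E"
  shows "card V \<le> Suc (card E)"
proof -
  have "finite E" using assms by (auto simp: connected_graph_def intro: simple_graph_finite_edges)
  then show ?thesis using spanning_connected_subgraph[OF assms] by (metis Suc_le_mono card_mono)
qed

lemma simple_graph_edgeE:
  assumes "simple_graph V E" "e \<in> E"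
  obtains u v where "e = {u, v}" "u \<noteq> v" "u \<in> V" "v \<in> V"
proof -
  have "e \<subseteq> V" "card e = 2" using assms by (auto simp: simple_graph_def)
  then show ?thesis using that by (auto simp: card_2_iff)
qed

lemma simple_graph_incident_edgeE:
  assumes "simple_graph V E" "e \<in> E" "v \<in> e"
  obtains a where "e = {v, a}" "a \<noteq> v" "a \<in> V"
proof -
  obtain x y where xy: "e = {x, y}" "x \<noteq> y" "x \<in> V" "y \<in> V"
    using simple_graph_edgeE[OF assms(1,2)] .
  show ?thesis
  proof (cases "v = x")
    case True
    then show ?thesis using that[of y] xy by simp
  next
    case False
    then show ?thesis using that[of x] xy assms(3) by (simp add: insert_commute)
  qed
qed

text \<open>An edge missing from a connected spanning \<open>F\<close> would close a cycle with a
  path in \<open>F\<close>, so the spanning subgraph with \<open>card V - 1\<close> edges is the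
  whole tree.\<close>

lemma tree_card:
  assumes "tree V E"
  shows "Suc (card E) = card V"
proof -
  have con: "connected_graph V E" and acyc: "\<nexists>c. cycle E c" using assms by (auto simp: tree_def)
  then have sg: "simple_graph V E" by (simp add: connected_graph_def)
  obtain F where F: "F \<subseteq> E" "connected_graph V F" "Suc (card F) = card V"
    using spanning_connected_subgraph[OF con] by blast
  have "e \<in> F" if e: "e \<in> E" for e
  proof (rule ccontr)
    assume "e \<notin> F"
    obtain u v where uv: "e = {u, v}" "u \<noteq> v" "u \<in> V" "v \<in> V" 
      using simple_graph_edgeE[OF sg e] .
    then have "(u, v) \<in> (adj F)\<^sup>*" using F by (auto simp: connected_graph_def)
    then show False using cycle_if_path_and_edge[of u v F E] F uv e \<open>e \<notin> F\<close> acyc by auto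
  qed
  then show ?thesis using F by (metis subset_antisym subsetI)
qed

section \<open>Deleting a leaf or an inner vertex\<close>

lemma degree_1_unique_edge:
  assumes "degree E v = 1"
  shows "\<exists>e\<in>E. v \<in> e \<and> (\<forall>f\<in>E. v \<in> f \<longrightarrow> f = e)"
proof -
  obtain e where "{e \<in> E. v \<in> e} = {e}"
    using assms unfolding degree_def by (rule card_1_singletonE)
  then show ?thesis by blast
qed

text \<open>A walk enters and leaves the leaf \<open>v\<close> only through its neighbour
  \<open>a\<close>, so visits to \<open>v\<close> can be replaced by staying at
  \<open>a\<close>.\<close>

lemma connected_delete_leaf:
  assumes "connected_graph V E" "e \<in> E" "v \<in> e" "\<forall>f\<in>E. v \<in> f \<longrightarrow> f = e"
  shows "connected_graph (V - {v}) (E - {e})"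
proof -
  have sg: "simple_graph V E" using assms by (simp add: connected_graph_def)
  obtain a where a: "e = {v, a}" "a \<noteq> v" "a \<in> V"
    using simple_graph_incident_edgeE[OF sg assms(2,3)] .
  \<comment> \<open>Redirecting the endpoint \<open>v\<close> to \<open>a\<close> lets the induction
    pass through walks that currently end in \<open>v\<close>.\<close>
  have *: "(x, if y = v then a else y) \<in> (adj (E - {e}))\<^sup>*"
    if "(x, y) \<in> (adj E)\<^sup>*" "x \<noteq> v" for x y
    using that
  proof (induction rule: rtrancl_induct)
    case (step y z)
    then have yz: "{y, z} \<in> E" by simp
    show ?case
    proof (cases "y = v \<or> z = v")
      case True
      \<comment> \<open>This step runs along \<open>e\<close>, so the redirected endpoint stays at
        \<open>a\<close>.\<close>
      then have "v \<in> {y, z}" by auto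
      then have "{y, z} = {v, a}" using assms(4) yz unfolding a(1) by simp
      then consider "y = v" "z = a" | "y = a" "z = v" unfolding doubleton_eq_iff by blast
      then show ?thesis using step.IH[OF step.prems] a(2) by cases simp_all
    next
      case False
      then have "{y, z} \<noteq> e" using assms(3) by auto
      then have "(y, z) \<in> adj (E - {e})" using yz by simp
      moreover have "(x, y) \<in> (adj (E - {e}))\<^sup>*" using step.IH[OF step.prems] False by simp
      ultimately show ?thesis using False by (simp add: rtrancl_into_rtrancl)
    qed
  qed simp
  have "simple_graph (V - {v}) (E - {e})"
    using sg assms(4) by (simp add: simple_graph_def subset_Diff_insert) blast
  moreover have "(x, y) \<in> (adj (E - {e}))\<^sup>*" if "x \<in> V - {v}" "y \<in> V - {v}" for x y
    using *[of x y] that assms(1) by (simp add: connected_graph_def)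
  moreover have "V - {v} \<noteq> {}" using a(2,3) by blast
  ultimately show ?thesis by (simp add: connected_graph_def)
qed

text \<open>Some edge must leave \<open>{v}\<close>. Thus a vertex whose degree is not 1 has degree
  at least 2.\<close>

lemma connected_degree_pos:
  assumes "connected_graph V E" "2 \<le> card V" "v \<in> V"
  shows "degree E v > 0"
proof -
  have sg: "simple_graph V E" using assms by (simp add: connected_graph_def)
  have "V \<noteq> {v}" using assms(2) by auto
  then obtain b where "b \<in> V" "b \<notin> {v}" using assms(3) by auto
  moreover have "(v, b) \<in> (adj E)\<^sup>*" using assms \<open>b \<in> V\<close> by (auto simp: connected_graph_def)
  ultimately obtain x y where "x \<in> {v}" "{x, y} \<in> E" using crossing_edge[of v b E "{v}"] by auto
  then have "{e \<in> E. v \<in> e} \<noteq> {}" by auto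
  then show ?thesis
    using simple_graph_finite_edges[OF sg] unfolding degree_def by (simp add: card_gt_0_iff)
qed

text \<open>A path in \<open>F\<close> between two neighbours of \<open>v\<close> would avoid
  \<open>v\<close> and close a cycle together with the two edges to \<open>v\<close>.\<close>

lemma tree_delete_inner_not_connected:
  assumes "tree V E" "degree E v \<ge> 2" "subgraph (V - {v}) F V E"
  shows "\<not> connected_graph (V - {v}) F"
proof
  assume con: "connected_graph (V - {v}) F"
  have acyc: "\<nexists>c. cycle E c" and sg: "simple_graph V E"
    using assms(1) by (auto simp: tree_def connected_graph_def)
  have F: "F \<subseteq> E" "simple_graph (V - {v}) F" using assms(3) by (auto simp: subgraph_def)
  obtain e f where ef: "e \<in> E" "v \<in> e" "f \<in> E" "v \<in> f" "e \<noteq> f"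
    using assms(2) card_le_Suc0_iff_eq[of "{e \<in> E. v \<in> e}"] simple_graph_finite_edges[OF sg]
    unfolding degree_def by fastforce
  obtain a where a: "e = {v, a}" "a \<noteq> v" "a \<in> V"
    using simple_graph_incident_edgeE[OF sg ef(1,2)] .
  obtain b where b: "f = {v, b}" "b \<noteq> v" "b \<in> V"
    using simple_graph_incident_edgeE[OF sg ef(3,4)] .
  \<comment> \<open>Adjoining \<open>e\<close> extends the path to start at \<open>v\<close>; the
    second edge \<open>f\<close> remains outside \<open>?F\<close> and closes the cycle.\<close>
  let ?F = "insert e F"
  have "(a, b) \<in> (adj F)\<^sup>*" using con a b by (auto simp: connected_graph_def)
  then have "(a, b) \<in> (adj ?F)\<^sup>*" by (rule rtrancl_adj_mono) auto
  then have "(v, b) \<in> (adj ?F)\<^sup>*" using a by (auto intro: converse_rtrancl_into_rtrancl)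
  moreover have "{v, b} \<notin> ?F" using F ef b by (auto simp: simple_graph_def)
  ultimately show False
    using cycle_if_path_and_edge[of v b ?F E] F ef b acyc by auto
qed

section \<open>Steiner distances of vertex sets missing one vertex\<close>

lemma steiner_dist_eqI:
  assumes "subgraph W F V E" "connected_graph W F" "S \<subseteq> W" "card F = m"
    and "\<And>W F. subgraph W F V E \<Longrightarrow> connected_graph W F \<Longrightarrow> S \<subseteq> W \<Longrightarrow> m \<le> card F"
  shows "steiner_dist V E S = m"
  unfolding steiner_dist_def by (rule Least_equality) (use assms in blast)+

text \<open>A competitor contains all vertices but possibly \<open>v\<close>. If \<open>v\<close> is
  a leaf, the tree without \<open>v\<close> attains the resulting bound; otherwise no connected
  competitor can omit \<open>v\<close>, and the whole tree is optimal.\<close>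

lemma steiner_dist_delete_vertex:
  assumes "tree V E" "2 \<le> card V" "v \<in> V"
  shows "steiner_dist V E (V - {v}) = (if degree E v = 1 then card V - 2 else card V - 1)"
proof -
  have con: "connected_graph V E" and sg: "simple_graph V E"
    using assms(1) by (auto simp: tree_def connected_graph_def)
  have finV: "finite V" using sg by (simp add: simple_graph_def)
  have cE: "Suc (card E) = card V" using tree_card[OF assms(1)] .
  show ?thesis
  proof (cases "degree E v = 1")
    case True
    obtain e where e: "e \<in> E" "v \<in> e" "\<forall>f\<in>E. v \<in> f \<longrightarrow> f = e"
      using degree_1_unique_edge[OF True] by blast
    have con': "connected_graph (V - {v}) (E - {e})" by (rule connected_delete_leaf[OF con e])
    have "steiner_dist V E (V - {v}) = card V - 2"
    proof (rule steiner_dist_eqI[OF _ con' subset_refl])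
      show "subgraph (V - {v}) (E - {e}) V E"
        using con' unfolding subgraph_def connected_graph_def by blast
      show "card (E - {e}) = card V - 2" using e(1) cE by simp
      fix W F assume WF: "subgraph W F V E" "connected_graph W F" "V - {v} \<subseteq> W"
      have "finite W" using WF(1) by (simp add: subgraph_def simple_graph_def)
      then have "card (V - {v}) \<le> card W" using WF(3) by (rule card_mono)
      then show "card V - 2 \<le> card F"
        using connected_graph_card_le[OF WF(2)] assms(3) finV by simp
    qed
    then show ?thesis using True by simp
  next
    case False
    then have deg: "2 \<le> degree E v" using connected_degree_pos[OF con assms(2,3)] by simp
    have "steiner_dist V E (V - {v}) = card V - 1"
    proof (rule steiner_dist_eqI[OF _ con])
      show "subgraph V E V E" using sg by (simp add: subgraph_def)
      show "card E = card V - 1" using cE by simp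
      fix W F assume WF: "subgraph W F V E" "connected_graph W F" "V - {v} \<subseteq> W"
      have "W \<noteq> V - {v}" using tree_delete_inner_not_connected[OF assms(1) deg] WF(1,2) by metis
      moreover have "W \<subseteq> V" using WF(1) by (simp add: subgraph_def)
      ultimately have "W = V" using WF(3) by blast
      then show "card V - 1 \<le> card F" using connected_graph_card_le[OF WF(2)] by simp
    qed auto
    then show ?thesis using False by simp
  qed
qed

section \<open>Contributions of single edges\<close>

text \<open>By connectedness, a further vertex would require an edge leaving \<open>{u, v}\<close>,
  which would be a second edge at a leaf.\<close>

lemma adjacent_leaves:
  assumes "connected_graph V E" "{u, v} \<in> E" "degree E u = 1" "degree E v = 1"
  shows "V = {u, v}"
proof -
  have "u \<in> V" "v \<in> V"
    using assms(1,2) unfolding connected_graph_def simple_graph_def by blast+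
  moreover have "w \<in> {u, v}" if "w \<in> V" for w
  proof (rule ccontr)
    assume "w \<notin> {u, v}"
    moreover have "(u, w) \<in> (adj E)\<^sup>*" using that \<open>u \<in> V\<close> assms(1) by (simp add: connected_graph_def)
    ultimately obtain x y where xy: "x \<in> {u, v}" "y \<notin> {u, v}" "{x, y} \<in> E"
      using crossing_edge[of u w E "{u, v}"] by blast
    have "degree E x = 1" using xy(1) assms(3,4) by blast
    from degree_1_unique_edge[OF this] obtain e where e: "\<forall>f\<in>E. x \<in> f \<longrightarrow> f = e" by blast
    have "{x, y} = {u, v}"
      using bspec[OF e xy(3)] bspec[OF e assms(2)] xy(1) by (metis insertI1)
    then show False using xy(2) by blast
  qed
  ultimately show ?thesis by blast
qed

text \<open>Here \<open>k - 1\<close> is the size of \<open>V - {u, v}\<close>, the only candidate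
  set. Adding one endpoint to it leaves out the other, which is why \<open>u\<close> and
  \<open>v\<close> appear swapped in the distances.\<close>

lemma closer_sets_card:
  assumes "simple_graph V E" "u \<noteq> v" "u \<in> V" "v \<in> V"
  shows "card (closer_sets V E {u, v} u (card V - 1)) =
      of_bool (steiner_dist V E (V - {v}) < steiner_dist V E (V - {u}))" (is ?closer)
    and "card (equidistant_sets V E {u, v} (card V - 1)) =
      of_bool (steiner_dist V E (V - {v}) = steiner_dist V E (V - {u}))" (is ?equi)
proof -
  have fin: "finite V" using assms by (simp add: simple_graph_def)
  have c: "card (V - {u, v}) = card V - 1 - 1" using assms by (simp add: card_Diff_subset)
  have S: "S \<subseteq> V - {u, v} \<and> card S = card V - 1 - 1 \<longleftrightarrow> S = V - {u, v}" for S
    using card_subset_eq[of "V - {u, v}" S] c fin by (metis finite_Diff subset_refl)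
  have collect: "{S. S \<subseteq> V - {u, v} \<and> card S = card V - 1 - 1 \<and> P S} =
      (if P (V - {u, v}) then {V - {u, v}} else {})" for P
    unfolding conj_assoc[symmetric] S by auto
  have eq: "V - {u, v} \<union> {u} = V - {v}" "V - {u, v} \<union> {v} = V - {u}" using assms by blast+
  show ?closer unfolding closer_sets_edge(1)[OF assms(2)] collect eq by simp
  show ?equi unfolding equidistant_sets_edge collect eq by simp
qed

text \<open>With exactly one leaf the distances differ, and both products are
  \<open>(1 + 1) * (0 + 1)\<close>. With no leaf they agree, so the products are
  \<open>1 * 1\<close> and \<open>(1/2 + 1) * (1/2 + 1)\<close>.\<close>

lemma edge_contribution:
  assumes "tree V E" "3 \<le> card V" "e \<in> E"
  shows "(\<Prod>w\<in>e. card (closer_sets V E e w (card V - 1)) + 1) =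
      (if e \<in> pendent_edges E then 2 else 1)" (is ?sz)
    and "(\<Prod>w\<in>e. real (card (closer_sets V E e w (card V - 1))) +
        real (card (equidistant_sets V E e (card V - 1))) / 2 + 1) =
      (if e \<in> pendent_edges E then 2 else 9 / 4)" (is ?rsz)
proof -
  have con: "connected_graph V E" and sg: "simple_graph V E"
    using assms(1) by (auto simp: tree_def connected_graph_def)
  obtain u v where e: "e = {u, v}" and uv: "u \<noteq> v" "u \<in> V" "v \<in> V"
    using simple_graph_edgeE[OF sg assms(3)] .
  have notboth: "\<not> (degree E u = 1 \<and> degree E v = 1)"
    using adjacent_leaves[OF con, of u v] assms e uv by auto
  have pend: "e \<in> pendent_edges E \<longleftrightarrow> degree E u = 1 \<or> degree E v = 1"
    using assms(3) e by (auto simp: pendent_edges_def)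
  have sd: "steiner_dist V E (V - {w}) = (if degree E w = 1 then card V - 2 else card V - 1)"
    if "w \<in> V" for w using steiner_dist_delete_vertex[OF assms(1) _ that] assms(2) by linarith
  \<comment> \<open>Subtraction on naturals truncates, so the strict gap between the two distances
    depends on the size of \<open>V\<close>.\<close>
  have less: "card V - 2 < card V - 1" using assms(2) by simp
  note cards = closer_sets_card[OF sg uv]
    closer_sets_card(1)[OF sg uv(1)[symmetric] uv(3,2), unfolded insert_commute[of v u]]
  have prod: "(\<Prod>w\<in>{u, v}. f w) = f u * f v" for f :: "'a \<Rightarrow> 'b::comm_monoid_mult"
    using uv(1) by simp
  show ?sz
    using notboth less unfolding pend unfolding e prod cards sd[OF uv(2)] sd[OF uv(3)] by auto
  show ?rsz
    using notboth less unfolding pend unfolding e prod cards sd[OF uv(2)] sd[OF uv(3)] by auto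
qed

theorem theorem4p1:
  fixes V :: "'a set" and E :: "'a set set" and n p :: nat
  assumes "tree V E"
    and "card V = n"
    and "n \<ge> 3"
    and "card (pendent_edges E) = p"
  shows "real (Sz (n - 1) V E) = real n + real p - 1 \<and>
         rSz (n - 1) V E = 2 * real p + 9 / 4 * (real n - real p - 1)"
proof -
  have sg: "simple_graph V E" using assms(1) by (auto simp: tree_def connected_graph_def)
  have fin: "finite E" using simple_graph_finite_edges[OF sg] .
  have sub: "pendent_edges E \<subseteq> E" by (auto simp: pendent_edges_def)
  have cE: "real (card E) = real n - 1" using tree_card[OF assms(1)] assms(2) by simp
  \<comment> \<open>There are \<open>n - 1\<close> edges, \<open>p\<close> of them pendent;
    \<open>a\<close> is 2 for both indices, while \<open>b\<close> is 1 for \<open>Sz\<close> and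
    \<open>9 / 4\<close> for \<open>rSz\<close>.\<close>
  have sum_split: "(\<Sum>e\<in>E. if e \<in> pendent_edges E then a else b) =
      real p * a + (real n - 1 - real p) * b" for a b :: real
  proof -
    have "E \<inter> {e. e \<in> pendent_edges E} = pendent_edges E"
      "E \<inter> - {e. e \<in> pendent_edges E} = E - pendent_edges E" using sub by auto
    moreover have "real (card (E - pendent_edges E)) = real n - 1 - real p"
      using card_Diff_subset[OF finite_subset[OF sub fin] sub] card_mono[OF fin sub] cE assms(4)
      by (simp add: of_nat_diff)
    ultimately show ?thesis using fin assms(4) by (simp add: sum.If_cases)
  qed
  have "real (Sz (n - 1) V E) = (\<Sum>e\<in>E. if e \<in> pendent_edges E then 2 else 1)"
    unfolding Sz_def of_nat_sum
    by (rule sum.cong) (use edge_contribution(1)[OF assms(1)] assms(2,3) in auto)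
  moreover have "rSz (n - 1) V E = (\<Sum>e\<in>E. if e \<in> pendent_edges E then 2 else 9 / 4)"
    unfolding rSz_def
    by (rule sum.cong) (use edge_contribution(2)[OF assms(1)] assms(2,3) in auto)
  ultimately show ?thesis unfolding sum_split by (simp add: field_simps)
qed

end
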